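(* Let $G$ be a finite abelian group with dual group $\hat G$, and let $\mathcal S\subseteq\hat G$ be symmetric (i.e. $\chi\in\mathcal S\Rightarrow\chi^{-1}\in\mathcal S$). Let $\Gamma$ be a chordal cover of the Cayley graph $\mathrm{Cay}(\hat G,\mathcal S)$, and for each maximal clique $\mathcal C$ of $\Gamma$ let $\chi_{\mathcal C}$ be an element of $\hat G$. Define $$\mathcal T=\mathcal T(\Gamma,\{\chi_{\mathcal C}\})=\bigcup_{\mathcal C}\chi_{\mathcal C}\,\mathcal C,$$ where the union is over all maximal cliques $\mathcal C$ of $\Gamma$ and $\chi_{\mathcal C}\,\mathcal C=\{\chi_{\mathcal C}\chi:\chi\in\mathcal C\}$. Then for every function $f:G\to\mathbb R$ with $f(x)\ge 0$ for all $x\in G$ that is supported on $\mathcal S$, there exist finitely many functions $f_1,\dots,f_J:G\to\mathbb C$, each supported on $\mathcal T$, such that $f(x)=\sum_{j=1}^J|f_j(x)|^2$ for all $x\in G$.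
   Context: $\hat G$ is the group (under pointwise multiplication) of characters of $G$, i.e. homomorphisms $G\to\mathbb C^*$; the inverse of $\chi$ is $\bar\chi$. Every $f:G\to\mathbb C$ has a unique Fourier expansion $f=\sum_{\chi\in\hat G}\hat f(\chi)\chi$. A function $f$ is supported on $\mathcal A\subseteq\hat G$ if $\hat f(\chi)=0$ for all $\chi\notin\mathcal A$. The Cayley graph $\mathrm{Cay}(\hat G,\mathcal S)$ is the simple graph with vertex set $\hat G$ in which two distinct vertices $\chi,\chi'$ are adjacent iff $\chi^{-1}\chi'\in\mathcal S$ ($\mathcal S$ need not generate $\hat G$). A graph is chordal if every cycle of length at least four has a chord; a chordal cover of a graph $(V,E)$ is a chordal graph $(V,E')$ with $E\subseteq E'$. A maximal clique is a clique that is not strictly contained in another clique. *)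

theory Defs
  imports Complex_Main "HOL-Algebra.Coset" "Graph_Theory.Graph_Theory"
begin

section \<open>Characters and Fourier expansions\<close>

definition complex_units :: "complex monoid" where
  "complex_units = \<lparr>carrier = - {0}, monoid.mult = (*), one = 1\<rparr>"

text \<open>
  A character lives on \<open>carrier G\<close> only; requiring extensionality makes two characters equal
  exactly if they agree on \<open>carrier G\<close>.
\<close>

definition dual_group :: "('a, 'b) monoid_scheme \<Rightarrow> ('a \<Rightarrow> complex) monoid" where
  "dual_group G =
     \<lparr>carrier = hom G complex_units \<inter> extensional (carrier G),
      monoid.mult = (\<lambda>\<chi> \<psi>. \<lambda>x\<in>carrier G. \<chi> x * \<psi> x),
      one = (\<lambda>x\<in>carrier G. 1)\<rparr>"

lemma (in group) comm_group_dual_group: "comm_group (dual_group G)"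
proof (rule comm_groupI)
  fix \<chi> assume "\<chi> \<in> carrier (dual_group G)"
  then have "(\<lambda>x\<in>carrier G. inverse (\<chi> x)) \<in> carrier (dual_group G)"
    and "(\<lambda>x\<in>carrier G. inverse (\<chi> x)) \<otimes>\<^bsub>dual_group G\<^esub> \<chi> = \<one>\<^bsub>dual_group G\<^esub>"
    by (auto simp: dual_group_def complex_units_def hom_def Pi_iff fun_eq_iff)
  then show "\<exists>\<psi>\<in>carrier (dual_group G). \<psi> \<otimes>\<^bsub>dual_group G\<^esub> \<chi> = \<one>\<^bsub>dual_group G\<^esub>"
    by blast
qed (auto simp: dual_group_def complex_units_def hom_def Pi_iff fun_eq_iff extensional_def)

text \<open>
  The coefficient family of the Fourier expansion, which is unique for finite abelian \<open>G\<close>.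
\<close>

definition fourier_coeff :: "('a, 'b) monoid_scheme \<Rightarrow> ('a \<Rightarrow> complex) \<Rightarrow> ('a \<Rightarrow> complex) \<Rightarrow> complex" where
  "fourier_coeff G f =
     (THE c. c \<in> extensional (carrier (dual_group G)) \<and>
             (\<forall>x\<in>carrier G. f x = (\<Sum>\<chi>\<in>carrier (dual_group G). c \<chi> * \<chi> x)))"

definition supported_on :: "('a, 'b) monoid_scheme \<Rightarrow> ('a \<Rightarrow> complex) \<Rightarrow> ('a \<Rightarrow> complex) set \<Rightarrow> bool" where
  "supported_on G f A \<longleftrightarrow> (\<forall>\<chi>\<in>carrier (dual_group G) - A. fourier_coeff G f \<chi> = 0)"


section \<open>Chordal covers of Cayley graphs\<close>

text \<open>
  A simple graph is a \<^locale>\<open>pair_graph\<close>: a finite loop-free digraph with symmetric arc relation,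
  an edge being represented by its two arcs.
\<close>

definition cayley_graph :: "('a, 'b) monoid_scheme \<Rightarrow> 'a set \<Rightarrow> 'a pair_pre_digraph" where
  "cayley_graph H S =
     \<lparr>pverts = carrier H,
      parcs = {(x, y). x \<in> carrier H \<and> y \<in> carrier H \<and> x \<noteq> y \<and> inv\<^bsub>H\<^esub> x \<otimes>\<^bsub>H\<^esub> y \<in> S}\<rparr>"

text \<open>
  A cycle is given by its list of arcs, so its vertices are the tails \<open>fst ` set p\<close>.  A chord
  joins two of them and is not an edge of the cycle, whichever way that edge is traversed.
\<close>

definition chordal :: "'a pair_pre_digraph \<Rightarrow> bool" where
  "chordal \<Gamma> \<longleftrightarrow>
     (\<forall>p. pre_digraph.cycle (with_proj \<Gamma>) p \<and> length p \<ge> 4 \<longrightarrow>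
        (\<exists>u \<in> fst ` set p. \<exists>v \<in> fst ` set p.
           (u, v) \<in> parcs \<Gamma> \<and> (u, v) \<notin> set p \<and> (v, u) \<notin> set p))"

definition chordal_cover :: "'a pair_pre_digraph \<Rightarrow> 'a pair_pre_digraph \<Rightarrow> bool" where
  "chordal_cover \<Gamma> X \<longleftrightarrow>
     pair_graph \<Gamma> \<and> chordal \<Gamma> \<and> spanning (with_proj X) (with_proj \<Gamma>)"

definition clique :: "'a pair_pre_digraph \<Rightarrow> 'a set \<Rightarrow> bool" where
  "clique \<Gamma> C \<longleftrightarrow> C \<subseteq> pverts \<Gamma> \<and> (\<forall>u\<in>C. \<forall>v\<in>C. u \<noteq> v \<longrightarrow> (u, v) \<in> parcs \<Gamma>)"

definition maximal_clique :: "'a pair_pre_digraph \<Rightarrow> 'a set \<Rightarrow> bool" where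
  "maximal_clique \<Gamma> C \<longleftrightarrow> clique \<Gamma> C \<and> (\<nexists>D. clique \<Gamma> D \<and> C \<subset> D)"

definition clique_translates ::
  "('a, 'b) monoid_scheme \<Rightarrow> 'a pair_pre_digraph \<Rightarrow> ('a set \<Rightarrow> 'a) \<Rightarrow> 'a set" where
  "clique_translates H \<Gamma> t = (\<Union>C\<in>{C. maximal_clique \<Gamma> C}. t C <#\<^bsub>H\<^esub> C)"

end

theory Submission
  imports Defs "HOL-Algebra.Multiplicative_Group"
begin

text \<open>
  The matrix \<open>M \<chi> \<psi> = (\<Sum>x. f x * \<chi> x * cnj (\<psi> x))\<close> is positive semidefinite because \<open>f \<ge> 0\<close>, and up to
  the factor \<open>order G\<close> its entries are the Fourier coefficients of \<open>f\<close> at \<open>\<chi>\<^sup>-\<^sup>1 \<psi>\<close>, so off the diagonal it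
  vanishes outside the edges of \<open>\<Gamma>\<close>.  Since \<open>\<Gamma>\<close> is chordal, eliminating simplicial vertices one by
  one writes \<open>M\<close> as a sum of rank-one matrices supported on cliques.  Each of them yields a square
  \<open>\<bar>F\<bar>\<^sup>2\<close> with \<open>F\<close> supported on a maximal clique, and multiplying \<open>F\<close> by a character translates the
  support without changing \<open>\<bar>F\<bar>\<close>.
\<close>

section \<open>Simplicial vertices of chordal graphs\<close>

lemma clique_subset: "clique \<Gamma> D \<Longrightarrow> C \<subseteq> D \<Longrightarrow> clique \<Gamma> C"
  unfolding clique_def by blast

lemma clique_Un:
  assumes "clique \<Gamma> C" "clique \<Gamma> D"
    and "\<And>u v. u \<in> C \<Longrightarrow> v \<in> D \<Longrightarrow> (u, v) \<in> parcs \<Gamma> \<and> (v, u) \<in> parcs \<Gamma>"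
  shows "clique \<Gamma> (C \<union> D)"
  using assms by (auto simp: clique_def)

context pair_pre_digraph begin

text \<open>With the next lemma, this lets walks be given by an index function \<open>g\<close>, so
  that later arguments are about natural numbers instead of arc lists.\<close>

lemma cas_map_upt:
  "k \<le> m \<Longrightarrow> pcas (g k) (map (\<lambda>i. (g i, g (Suc i))) [k..<m]) (g m)"
  by (induction "m - k" arbitrary: k) (auto simp: upt_rec)

lemma awalk_verts_map_upt:
  "k \<le> m \<Longrightarrow> pawalk_verts (g k) (map (\<lambda>i. (g i, g (Suc i))) [k..<m]) = map g [k..<Suc m]"
  by (induction "m - k" arbitrary: k) (auto simp: upt_rec)

end

text \<open>The arc list read off from \<open>g\<close> is a \<open>cycle\<close> of length m, so
  \<open>chordal\<close> applies to it; the chord is handed back as a pair of indices.\<close>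

lemma (in pair_graph) chordal_cycle_chord:
  assumes "chordal G" and "m \<ge> 4" and "g m = g 0" and inj: "inj_on g {..<m}"
    and arcs: "\<And>i. i < m \<Longrightarrow> (g i, g (Suc i)) \<in> parcs G"
  obtains i j where "i < m" "j < m" "(g i, g j) \<in> parcs G"
    "\<And>k. k < m \<Longrightarrow> (g i, g j) \<noteq> (g k, g (Suc k))" "\<And>k. k < m \<Longrightarrow> (g j, g i) \<noteq> (g k, g (Suc k))"
proof -
  define p where "p = map (\<lambda>i. (g i, g (Suc i))) [0..<m]"
  have set_p: "set p = (\<lambda>i. (g i, g (Suc i))) ` {..<m}"
    by (auto simp: p_def)
  have "g 0 \<in> pverts G"
    using arcs[of 0] \<open>m \<ge> 4\<close> in_arcsD1 by auto
  then have "awalk (g 0) p (g 0)"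
    using cas_map_upt[of 0 m g] arcs \<open>g m = g 0\<close> unfolding awalk_def by (auto simp: p_def)
  moreover have "distinct (map g [1..<Suc m])"
  proof -
    have "inj_on g {1..<Suc m}"
    proof (rule inj_onI)
      fix i j assume ij: "i \<in> {1..<Suc m}" "j \<in> {1..<Suc m}" "g i = g j"
      \<comment> \<open>The distinct vertices of the arc list are those at 1, ..., m;
        \<open>h\<close> folds m back to 0, where injectivity of \<open>g\<close> below m
        applies.\<close>
      define h where "h i = (if i = m then 0 else i)" for i
      have "g (h i) = g (h j)" "h i < m" "h j < m"
        using ij \<open>g m = g 0\<close> by (auto simp: h_def)
      then have "h i = h j"
        using inj by (auto dest: inj_onD)
      then show "i = j"
        using ij by (auto simp: h_def split: if_splits)
    qed
    then show ?thesis
      by (simp add: distinct_map del: upt_Suc)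
  qed
  then have "distinct (tl (pawalk_verts (g 0) p))"
    unfolding p_def awalk_verts_map_upt[OF le0] by (simp add: upt_rec)
  ultimately have "cycle p"
    unfolding cycle_def using \<open>m \<ge> 4\<close> by (auto simp: p_def)
  moreover have "length p = m"
    by (simp add: p_def)
  ultimately obtain u v where uv: "u \<in> fst ` set p" "v \<in> fst ` set p" "(u, v) \<in> parcs G"
    "(u, v) \<notin> set p" "(v, u) \<notin> set p"
    using \<open>chordal G\<close> \<open>m \<ge> 4\<close> unfolding chordal_def by metis
  then obtain i j where "i < m" "j < m" "u = g i" "v = g j"
    by (auto simp: set_p)
  with uv show thesis
    unfolding set_p by (intro that[of i j]) auto
qed

text \<open>A shortest walk from \<open>s\<close> to \<open>s'\<close> through \<open>A\<close> closes up at \<open>b\<close> to a chordless cycle, unless \<open>s\<close>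
  and \<open>s'\<close> are adjacent.\<close>

lemma (in pair_graph) chordal_separator_adjacent:
  assumes chordal: "chordal G"
    and path: "(s, s') \<in> (parcs G \<inter> (A \<union> {s, s'}) \<times> (A \<union> {s, s'}))\<^sup>*"
    and "s \<noteq> s'" and b: "b \<notin> A" "(b, s) \<in> parcs G" "(b, s') \<in> parcs G"
    and nb: "\<And>a. a \<in> A \<Longrightarrow> (b, a) \<in> parcs G \<Longrightarrow> a = s \<or> a = s'"
  shows "(s, s') \<in> parcs G"
proof (rule ccontr)
  assume nadj: "(s, s') \<notin> parcs G"
  define R where "R = parcs G \<inter> (A \<union> {s, s'}) \<times> (A \<union> {s, s'})"
  have sym: "(v, u) \<in> parcs G" if "(u, v) \<in> parcs G" for u v
    using that pair_sym_arcs by (auto simp: symmetric_def dest: symD)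
  have bns: "b \<noteq> s" "b \<noteq> s'"
    using b pair_no_loops by force+
  define n where "n = (LEAST n. (s, s') \<in> R ^^ n)"
  obtain n0 where "(s, s') \<in> R ^^ n0"
    using path rtrancl_imp_relpow unfolding R_def by blast
  then have "(s, s') \<in> R ^^ n"
    unfolding n_def by (rule LeastI)
  have least: "n \<le> k" if "(s, s') \<in> R ^^ k" for k
    unfolding n_def using that by (rule Least_le)
  from \<open>(s, s') \<in> R ^^ n\<close> obtain f where
    f: "f 0 = s" "f n = s'" "\<And>i. i < n \<Longrightarrow> (f i, f (Suc i)) \<in> R"
    unfolding relpow_fun_conv by blast
  have seg: "(f i, f (i + k)) \<in> R ^^ k" if "i + k \<le> n" for i k
    using that unfolding relpow_fun_conv by (intro exI[of _ "\<lambda>l. f (i + l)"]) (auto intro: f)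
  \<comment> \<open>Replacing the part of the shortest walk between i and j by k steps cannot
    shorten it. The case k = 0 makes \<open>f\<close> injective, the case k = 1 excludes arcs that
    skip vertices forwards.\<close>
  have shortcut: "n \<le> i + k + (n - j)" if "(f i, f j) \<in> R ^^ k" "i \<le> n" "j \<le> n" for i j k
  proof (rule least)
    have "(s, f i) \<in> R ^^ i" "(f j, s') \<in> R ^^ (n - j)"
      using seg[of 0 i] seg[of j "n - j"] that f by auto
    then show "(s, s') \<in> R ^^ (i + k + (n - j))"
      using that(1) by (auto simp: relpow_add)
  qed
  have "n \<noteq> 0"
    using f(1,2) \<open>s \<noteq> s'\<close> by (metis)
  moreover have "n \<noteq> 1"
    using f(3)[of 0] f nadj by (auto simp: R_def)
  ultimately have "n \<ge> 2"
    by simp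
  have f_mem: "f i \<in> A \<union> {s, s'}" if "i \<le> n" for i
    using f(3)[of i] f(2) that by (cases "i = n") (auto simp: R_def)
  have fb: "f i \<noteq> b" if "i \<le> n" for i
    using f_mem[OF that] b bns by auto
  have inj_le: False if "f i = f j" "i < j" "j \<le> n" for i j
    using shortcut[of i j 0] that by simp
  have inj: "i = j" if "f i = f j" "i \<le> n" "j \<le> n" for i j
    using inj_le[of i j] inj_le[of j i] that by (metis linorder_neqE_nat)
  have no_chord: "j \<le> Suc i" if "(f i, f j) \<in> parcs G" "i \<le> n" "j \<le> n" for i j
  proof -
    have "(f i, f j) \<in> R ^^ 1"
      using that f_mem[of i] f_mem[of j] by (auto simp: R_def)
    from shortcut[OF this] that show ?thesis
      by simp
  qed
  \<comment> \<open>The cycle runs through b, f 0, ..., f n and back to b, so f i sits at index i +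
    1. Its length n + 2 is at least 4 because n is at least 2.\<close>
  define g where "g i = (if i = 0 \<or> i = n + 2 then b else f (i - 1))" for i
  have nbf: "i = 0 \<or> i = n" if "(b, f i) \<in> parcs G" "i \<le> n" for i
  proof -
    have "f i = s \<or> f i = s'"
      using f_mem[of i] nb[of "f i"] that by blast
    then show ?thesis
      using inj[of i 0] inj[of i n] f that by auto
  qed
  have g0: "g 0 = b"
    by (simp add: g_def)
  have gS: "g (Suc i) = f i" if "i \<le> n" for i
    using that by (simp add: g_def)
  have g_lt: "i = 0 \<or> (\<exists>i'\<le>n. i = Suc i')" if "i < n + 2" for i
    using that by (cases i) auto
  obtain i j where ij: "i < n + 2" "j < n + 2" "(g i, g j) \<in> parcs G"
    "\<And>k. k < n + 2 \<Longrightarrow> (g i, g j) \<noteq> (g k, g (Suc k))"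
    "\<And>k. k < n + 2 \<Longrightarrow> (g j, g i) \<noteq> (g k, g (Suc k))"
  proof (rule chordal_cycle_chord[OF chordal, of "n + 2" g])
    show "inj_on g {..<n + 2}"
    proof (rule inj_onI)
      fix x y assume "x \<in> {..<n + 2}" "y \<in> {..<n + 2}" "g x = g y"
      then show "x = y"
        using g_lt[of x] g_lt[of y] by (auto simp: gS g0 fb fb[symmetric] intro: inj)
    qed
    show "(g k, g (Suc k)) \<in> parcs G" if k: "k < n + 2" for k
    proof -
      consider "k = 0" | k' where "k = Suc k'" "k' < n" | "k = Suc n"
        using k by (cases k) (auto simp: less_Suc_eq)
      then show ?thesis
      proof cases
        case 1 then show ?thesis using b f by (simp add: g_def)
      next
        case 2 then show ?thesis using f(3)[of k'] by (simp add: gS R_def)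
      next
        case 3 then show ?thesis using sym[OF b(3)] f by (simp add: g_def)
      qed
    qed
  qed (use \<open>n \<ge> 2\<close> in \<open>auto simp: g_def\<close>)
  \<comment> \<open>By symmetry i may be taken as the smaller index. A chord at b would end in f 0
    or f n by \<open>nbf\<close>, and any other chord joins consecutive vertices by
    \<open>no_chord\<close>; both are edges of the cycle.\<close>
  have main: False if ij: "i < n + 2" "j < n + 2" "i \<le> j" "(g i, g j) \<in> parcs G"
    "\<And>k. k < n + 2 \<Longrightarrow> (g i, g j) \<noteq> (g k, g (Suc k))"
    "\<And>k. k < n + 2 \<Longrightarrow> (g j, g i) \<noteq> (g k, g (Suc k))" for i j
  proof -
    have "i \<noteq> j"
      using ij(4) pair_no_loops by force
    with ij obtain j' where j': "j = Suc j'" "j' \<le> n"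
      using g_lt[of j] by auto
    show False
    proof (cases i)
      case 0
      then have "j' = 0 \<or> j' = n"
        using ij(4) j' by (intro nbf) (auto simp: gS, simp add: g_def)
      then show False
        using ij(5)[of 0] ij(6)[of "Suc n"] j' 0 by (auto simp: g_def split: if_splits)
    next
      case (Suc i')
      then have "j' \<le> Suc i'"
        using ij j' by (intro no_chord) (auto simp: gS)
      then have "j = Suc i"
        using j' Suc \<open>i \<noteq> j\<close> \<open>i \<le> j\<close> by simp
      then show False
        using ij(5)[of i] ij(1) by simp
    qed
  qed
  show False
    using main[of i j] main[of j i] ij sym by (cases "i \<le> j") auto
qed

text \<open>
  Among the connected sets \<open>A\<close> whose closed neighbourhood is not all of \<open>W\<close>, take a maximal one.
  Its boundary \<open>N A\<close> is then completely joined to the remaining set \<open>B\<close>, and is a clique by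
  chordality, so a simplicial vertex of \<open>B\<close> is simplicial in \<open>W\<close>.
\<close>

lemma (in pair_graph) chordal_simplicial_vertex:
  assumes "chordal G" and "W \<subseteq> pverts G" and "W \<noteq> {}"
  shows "\<exists>v\<in>W. clique G (insert v {u\<in>W. (v, u) \<in> parcs G})"
  using assms(2,3)
proof (induction "card W" arbitrary: W rule: less_induct)
  case less
  have sym: "(v, u) \<in> parcs G" if "(u, v) \<in> parcs G" for u v
    using that pair_sym_arcs by (auto simp: symmetric_def dest: symD)
  have fin: "finite W"
    using less.prems pair_finite_verts finite_subset by blast
  define N where "N A = {u\<in>W - A. \<exists>a\<in>A. (a, u) \<in> parcs G}" for A
  define conn where "conn A \<longleftrightarrow> A \<subseteq> W \<and> A \<noteq> {} \<and> A \<union> N A \<noteq> W \<and>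
    (\<forall>x\<in>A. \<forall>y\<in>A. (x, y) \<in> (parcs G \<inter> A \<times> A)\<^sup>*)" for A
  show ?case
  proof (cases "\<exists>A. conn A")
    \<comment> \<open>A vertex v with a nonneighbour u in W would give the set {v} with
      \<open>conn\<close>; hence W is complete.\<close>
    case False
    have "(v, u) \<in> parcs G" if "v \<in> W" "u \<in> W" "u \<noteq> v" for u v
    proof -
      have "{v} \<union> N {v} = W"
        using False that by (auto simp: conn_def)
      then show ?thesis
        using that by (auto simp: N_def)
    qed
    then have "clique G W"
      using less.prems by (auto simp: clique_def)
    then show ?thesis
      using less.prems by (auto simp: clique_def)
  next
    case True
    have "\<forall>A. conn A \<longrightarrow> card A < Suc (card W)"
      using fin by (auto simp: conn_def less_Suc_eq_le intro: card_mono)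
    with True obtain A where A: "conn A" and max: "\<And>B. conn B \<Longrightarrow> card B \<le> card A"
      using ex_has_greatest_nat[of conn _ card "Suc (card W)"] by blast
    define B where "B = W - (A \<union> N A)"
    have AW: "A \<subseteq> W" "A \<noteq> {}" and NW: "N A \<subseteq> W"
      and A_conn: "\<And>x y. x \<in> A \<Longrightarrow> y \<in> A \<Longrightarrow> (x, y) \<in> (parcs G \<inter> A \<times> A)\<^sup>*"
      using A by (auto simp: conn_def N_def)
    have "B \<noteq> {}" "B \<subseteq> W" "B \<noteq> W"
      using A NW by (auto simp: B_def conn_def)
    then have "card B < card W"
      using fin by (intro psubset_card_mono) auto
    with less.hyps[of B] \<open>B \<noteq> {}\<close> \<open>B \<subseteq> W\<close> less.prems obtain b where
      "b \<in> B" and b: "clique G (insert b {u\<in>B. (b, u) \<in> parcs G})"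
      by auto
    \<comment> \<open>Otherwise adding s to A keeps it connected and still leaves b outside its
      closed neighbourhood, against maximality of A.\<close>
    have sep: "(s, b) \<in> parcs G" if s: "s \<in> N A" and b: "b \<in> B" for s b
    proof (rule ccontr)
      assume nsb: "(s, b) \<notin> parcs G"
      let ?A = "insert s A"
      let ?R = "(parcs G \<inter> ?A \<times> ?A)\<^sup>*"
      obtain a where a: "a \<in> A" "(a, s) \<in> parcs G"
        using s by (auto simp: N_def)
      have R: "(x, y) \<in> ?R" if "x \<in> A" "y \<in> A" for x y
        using A_conn[OF that] by (rule rtrancl_mono[THEN subsetD, rotated]) auto
      have as: "(a, s) \<in> ?R" "(s, a) \<in> ?R"
        using a sym by auto
      have "(x, y) \<in> ?R" if "x \<in> ?A" "y \<in> ?A" for x y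
        using that R[of x a] R[of a y] R[of x y] as a by (auto intro: rtrancl_trans)
      moreover have "b \<notin> ?A \<union> N ?A"
        using b s nsb by (auto simp: B_def N_def)
      ultimately have "conn ?A"
        using AW s b NW by (auto simp: conn_def B_def N_def)
      moreover have "finite A" "s \<notin> A"
        using AW fin finite_subset s by (auto simp: N_def)
      ultimately show False
        using max[of ?A] by simp
    qed
    have nAB: "(b, a) \<notin> parcs G" if "a \<in> A" "b \<in> B" for a b
      using that sym by (auto simp: B_def N_def)
    have "(s, s') \<in> parcs G" if s: "s \<in> N A" "s' \<in> N A" "s \<noteq> s'" for s s'
    proof (rule chordal_separator_adjacent[OF \<open>chordal G\<close>, where A = A and b = b])
      obtain a a' where a: "a \<in> A" "(a, s) \<in> parcs G" "a' \<in> A" "(a', s') \<in> parcs G"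
        using s by (auto simp: N_def)
      let ?R = "parcs G \<inter> (A \<union> {s, s'}) \<times> (A \<union> {s, s'})"
      have "(s, a) \<in> ?R" "(a', s') \<in> ?R"
        using a sym by auto
      moreover have "(a, a') \<in> ?R\<^sup>*"
        using A_conn[OF a(1,3)] by (rule rtrancl_mono[THEN subsetD, rotated]) auto
      ultimately show "(s, s') \<in> ?R\<^sup>*"
        by (meson converse_rtrancl_into_rtrancl rtrancl.rtrancl_into_rtrancl)
    qed (use s sep[OF _ \<open>b \<in> B\<close>] nAB[OF _ \<open>b \<in> B\<close>] sym \<open>b \<in> B\<close> in \<open>auto simp: B_def\<close>)
    then have N_clique: "clique G (N A)"
      using NW less.prems(1) by (auto simp: clique_def)
    have "(u, s) \<in> parcs G \<and> (s, u) \<in> parcs G"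
      if "u \<in> insert b {u\<in>B. (b, u) \<in> parcs G}" "s \<in> N A" for u s
      using sep[of s u] sym that \<open>b \<in> B\<close> by auto
    then have "clique G (insert b {u\<in>B. (b, u) \<in> parcs G} \<union> N A)"
      by (rule clique_Un[OF b N_clique])
    moreover have "insert b {u\<in>W. (b, u) \<in> parcs G} \<subseteq> insert b {u\<in>B. (b, u) \<in> parcs G} \<union> N A"
      using nAB[OF _ \<open>b \<in> B\<close>] by (auto simp: B_def)
    ultimately have "clique G (insert b {u\<in>W. (b, u) \<in> parcs G})"
      by (rule clique_subset)
    then show ?thesis
      using \<open>b \<in> B\<close> \<open>B \<subseteq> W\<close> by auto
  qed
qed

lemma (in pair_graph) clique_maximal_extension:
  assumes "clique G C"
  shows "\<exists>D. maximal_clique G D \<and> C \<subseteq> D"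
proof -
  have "finite {D. clique G D \<and> C \<subseteq> D}"
    using pair_finite_verts by (rule finite_subset[rotated, OF finite_Pow_iff[THEN iffD2]]) (auto simp: clique_def)
  moreover have "{D. clique G D \<and> C \<subseteq> D} \<noteq> {}"
    using assms by auto
  ultimately obtain D where "D \<in> {D. clique G D \<and> C \<subseteq> D}"
    and "\<And>E. E \<in> {D. clique G D \<and> C \<subseteq> D} \<Longrightarrow> D \<subseteq> E \<Longrightarrow> D = E"
    using finite_has_maximal by metis
  then show ?thesis
    unfolding maximal_clique_def by (intro exI[of _ D]) blast
qed

section \<open>Fourier expansions on finite abelian groups\<close>

lemma dual_group_simps [simp]:
  "\<chi> \<otimes>\<^bsub>dual_group G\<^esub> \<psi> = (\<lambda>x\<in>carrier G. \<chi> x * \<psi> x)"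
  "\<one>\<^bsub>dual_group G\<^esub> = (\<lambda>x\<in>carrier G. 1)"
  by (auto simp: dual_group_def)

lemma mem_dual_group_iff:
  "\<chi> \<in> carrier (dual_group G) \<longleftrightarrow>
     (\<forall>x\<in>carrier G. \<chi> x \<noteq> 0) \<and>
     (\<forall>x\<in>carrier G. \<forall>y\<in>carrier G. \<chi> (x \<otimes>\<^bsub>G\<^esub> y) = \<chi> x * \<chi> y) \<and> \<chi> \<in> extensional (carrier G)"
  by (auto simp: dual_group_def complex_units_def hom_def)

locale finite_comm_group = comm_group G for G (structure) +
  assumes finite_carrier [simp]: "finite (carrier G)"
begin

abbreviation Ghat where "Ghat \<equiv> carrier (dual_group G)"

lemma character_mult: "\<chi> \<in> Ghat \<Longrightarrow> x \<in> carrier G \<Longrightarrow> y \<in> carrier G \<Longrightarrow> \<chi> (x \<otimes> y) = \<chi> x * \<chi> y"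
  and character_nonzero: "\<chi> \<in> Ghat \<Longrightarrow> x \<in> carrier G \<Longrightarrow> \<chi> x \<noteq> 0"
  by (auto simp: mem_dual_group_iff)

lemma character_one: "\<chi> \<in> Ghat \<Longrightarrow> \<chi> \<one> = 1"
  using character_mult[of \<chi> \<one> \<one>] character_nonzero[of \<chi> \<one>] by simp

lemma character_pow: "\<chi> \<in> Ghat \<Longrightarrow> x \<in> carrier G \<Longrightarrow> \<chi> (x [^] (n::nat)) = \<chi> x ^ n"
  by (induction n) (auto simp: character_one character_mult mult.commute)

lemma order_pos: "order G > 0"
  by (simp add: order_gt_0_iff_finite)

lemma character_root_of_unity: "\<chi> \<in> Ghat \<Longrightarrow> x \<in> carrier G \<Longrightarrow> \<chi> x ^ order G = 1"
  using character_pow[of \<chi> x "order G"] by (simp add: pow_order_eq_1 character_one)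

lemma norm_character: "\<chi> \<in> Ghat \<Longrightarrow> x \<in> carrier G \<Longrightarrow> norm (\<chi> x) = 1"
  using character_root_of_unity[of \<chi> x] order_pos
  by (metis norm_one norm_power norm_ge_zero power_eq_imp_eq_base power_one zero_le_one)

lemma cnj_character: "\<chi> \<in> Ghat \<Longrightarrow> x \<in> carrier G \<Longrightarrow> cnj (\<chi> x) = inverse (\<chi> x)"
  using norm_character[of \<chi> x] complex_norm_square[of "\<chi> x"]
  by (simp add: inverse_unique)

text \<open>Character values are roots of unity of exponent \<open>order G\<close>, so each of the
  finitely many points admits finitely many values.\<close>

lemma finite_dual_group [simp]: "finite Ghat"
proof (rule finite_subset)
  show "Ghat \<subseteq> (\<Pi>\<^sub>E x\<in>carrier G. {z. z ^ order G = 1})"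
    by (intro subsetI) (auto simp: character_root_of_unity PiE_iff, simp add: mem_dual_group_iff extensional_def)
  show "finite (\<Pi>\<^sub>E x\<in>carrier G. {z::complex. z ^ order G = 1})"
    using order_pos by (intro finite_PiE) (auto intro: finite_roots_unity)
qed

lemma inv_dual_group:
  assumes "\<chi> \<in> Ghat"
  shows "inv\<^bsub>dual_group G\<^esub> \<chi> = (\<lambda>x\<in>carrier G. inverse (\<chi> x))"
proof -
  interpret D: comm_group "dual_group G"
    by (rule comm_group_dual_group)
  have "(\<lambda>x\<in>carrier G. inverse (\<chi> x)) \<in> Ghat"
    using assms by (auto simp: mem_dual_group_iff)
  then show ?thesis
    using assms by (intro D.inv_equality) (auto simp: character_nonzero)
qed

lemma sum_translate:
  assumes "a \<in> carrier G"
  shows "(\<Sum>x\<in>carrier G. h (a \<otimes> x)) = (\<Sum>x\<in>carrier G. h x)"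
  using inj_on_multc[OF assms]
  by (intro sum.reindex_bij_betw)
     (auto simp: bij_betw_def surj_const_mult assms inj_on_cmult)

text \<open>For distinct characters, translation by a point \<open>a\<close> where they differ
  multiplies the sum by \<open>\<chi> a * cnj (\<psi> a)\<close>, which is not 1, yet leaves the sum
  unchanged.\<close>

lemma character_orthogonality:
  assumes "\<chi> \<in> Ghat" "\<psi> \<in> Ghat"
  shows "(\<Sum>x\<in>carrier G. \<chi> x * cnj (\<psi> x)) = (if \<chi> = \<psi> then of_nat (order G) else 0)"
proof (cases "\<chi> = \<psi>")
  case True
  then show ?thesis
    using assms by (simp add: cnj_character character_nonzero order_def)
next
  case False
  then obtain a where a: "a \<in> carrier G" "\<chi> a \<noteq> \<psi> a"
    using assms by (metis extensionalityI mem_dual_group_iff)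
  let ?s = "\<Sum>x\<in>carrier G. \<chi> x * cnj (\<psi> x)"
  have "?s = (\<Sum>x\<in>carrier G. \<chi> (a \<otimes> x) * cnj (\<psi> (a \<otimes> x)))"
    using sum_translate[OF a(1), of "\<lambda>x. \<chi> x * cnj (\<psi> x)"] by simp
  also have "\<dots> = (\<chi> a * cnj (\<psi> a)) * ?s"
    unfolding sum_distrib_left using assms a by (intro sum.cong) (auto simp: character_mult)
  finally have "(\<chi> a * cnj (\<psi> a) - 1) * ?s = 0"
    by (simp add: algebra_simps)
  moreover have "\<chi> a * cnj (\<psi> a) \<noteq> 1"
    using assms a by (simp add: cnj_character character_nonzero field_simps)
  ultimately show ?thesis
    using False by simp
qed

text \<open>Every function is a sum of eigenvectors of the translation by \<open>g\<close>: average its translates by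
  powers of \<open>g\<close> against powers of a root of unity.\<close>

lemma translation_eigen_decomposition:
  fixes f :: "'a \<Rightarrow> complex"
  assumes g: "g \<in> carrier G"
  defines "n \<equiv> order G"
  defines "w \<equiv> cis (2 * pi / n)"
  defines "P \<equiv> \<lambda>k x. (\<Sum>j<n. inverse w ^ (j * k) * f (x \<otimes> g [^] j)) / n"
  shows "x \<in> carrier G \<Longrightarrow> f x = (\<Sum>k<n. P k x)"
    and "x \<in> carrier G \<Longrightarrow> P k (x \<otimes> g) = w ^ k * P k x"
proof -
  have n: "n > 0"
    using order_pos by (simp add: n_def)
  have w: "w \<noteq> 0" "w ^ n = 1"
    using n by (auto simp: w_def DeMoivre)
  assume x: "x \<in> carrier G"
  \<comment> \<open>For 0 < j < n the base z is an n-th root of unity other than 1, by injectivity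
    of the enumeration of these roots, so the geometric sum vanishes.\<close>
  have geom: "(\<Sum>k<n. inverse w ^ (j * k)) = (if j = 0 then of_nat n else 0)" if "j < n" for j
  proof (cases "j = 0")
    case False
    define z where "z = inverse w ^ j"
    have "z \<noteq> 1"
    proof
      assume "z = 1"
      then have "w ^ j = 1"
        by (simp add: z_def power_inverse)
      then have "cis (2 * pi * real j / real n) = cis (2 * pi * real 0 / real n)"
        by (simp add: w_def DeMoivre mult_ac)
      with bij_betw_roots_unity[OF n] have "j = 0"
        using \<open>j < n\<close> n unfolding bij_betw_def inj_on_def by blast
      with False show False ..
    qed
    moreover have "z ^ n = 1"
      using w by (simp add: z_def power_inverse flip: power_mult)
        (metis mult.commute power_mult power_one)
    ultimately have "(\<Sum>k<n. z ^ k) = 0"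
      by (simp add: geometric_sum)
    then show ?thesis
      using False by (simp add: z_def power_mult)
  qed auto
  have "(\<Sum>k<n. P k x) = (\<Sum>j<n. (\<Sum>k<n. inverse w ^ (j * k)) * f (x \<otimes> g [^] j)) / n"
    unfolding P_def sum_divide_distrib[symmetric] sum_distrib_right
    by (subst sum.swap) simp
  also have "\<dots> = (\<Sum>j<n. (if j = 0 then of_nat n else 0) * f (x \<otimes> g [^] j)) / n"
    by (simp add: geom)
  also have "\<dots> = (\<Sum>j<n. if j = 0 then of_nat n * f x else 0) / n"
    using x by (intro arg_cong2[of _ _ _ _ "(/)"] sum.cong) auto
  also have "\<dots> = f x"
    using n by simp
  finally show "f x = (\<Sum>k<n. P k x)" ..
  \<comment> \<open>Since \<open>a n = a 0\<close>, the index may be shifted cyclically; translating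
    by g is such a shift, up to the eigenvalue \<open>w ^ k\<close>.\<close>
  define a where "a j = inverse w ^ (j * k) * f (x \<otimes> g [^] j)" for j
  have a_n: "a n = a 0"
    using g x w by (simp add: a_def n_def pow_order_eq_1 power_inverse power_mult)
  have "(\<Sum>j<n. a (Suc j)) = (\<Sum>j<n. a j)"
    using sum.lessThan_Suc_shift[of a n] a_n by simp
  moreover have "inverse w ^ (j * k) * f (x \<otimes> g \<otimes> g [^] j) = w ^ k * a (Suc j)" for j
    using g x w by (simp add: a_def nat_pow_Suc2 m_assoc m_comm[of g "g [^] j"] power_inverse power_add)
  ultimately show "P k (x \<otimes> g) = w ^ k * P k x"
    unfolding P_def by (simp flip: sum_distrib_left a_def)
qed

text \<open>A simultaneous eigenvector of all translations is a multiple of a character, so splitting a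
  function by one translation after the other expands it in characters.\<close>

lemma characters_span:
  fixes f :: "'a \<Rightarrow> complex"
  shows "\<exists>c. \<forall>x\<in>carrier G. f x = (\<Sum>\<chi>\<in>Ghat. c \<chi> * \<chi> x)"
proof -
  define E where "E A = {h :: 'a \<Rightarrow> complex. \<forall>g\<in>A. \<exists>l. \<forall>x\<in>carrier G. h (x \<otimes> g) = l * h x}" for A
  define spanned where "spanned h \<longleftrightarrow> (\<exists>c. \<forall>x\<in>carrier G. h x = (\<Sum>\<chi>\<in>Ghat. c \<chi> * \<chi> x))"
    for h :: "'a \<Rightarrow> complex"
  \<comment> \<open>The value of h at x is its eigenvalue \<open>l x\<close> times
    \<open>h \<one>\<close>. If \<open>h \<one>\<close> is 0, so is h on the group; otherwise
    cancelling \<open>h \<one>\<close> shows that \<open>l\<close> is multiplicative.\<close>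
  have joint: "spanned h" if "h \<in> E (carrier G)" for h
  proof -
    have "\<forall>g\<in>carrier G. \<exists>l. \<forall>x\<in>carrier G. h (x \<otimes> g) = l * h x"
      using that by (simp add: E_def)
    from bchoice[OF this] obtain l where
      l: "\<forall>g\<in>carrier G. \<forall>x\<in>carrier G. h (x \<otimes> g) = l g * h x" ..
    have h: "h g = l g * h \<one>" if "g \<in> carrier G" for g
      using l[rule_format, of g \<one>] that by simp
    show ?thesis
    proof (cases "h \<one> = 0")
      case True
      then have "h x = 0" if "x \<in> carrier G" for x
        using h[OF that] by simp
      then show ?thesis
        unfolding spanned_def by (intro exI[of _ "\<lambda>_. 0"]) simp
    next
      case False
      define \<chi> where "\<chi> = restrict l (carrier G)"
      have l_mult: "l (x \<otimes> y) = l x * l y" if "x \<in> carrier G" "y \<in> carrier G" for x y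
      proof -
        have "l (x \<otimes> y) * h \<one> = l y * h x"
          by (rule trans[OF sym[OF h[OF m_closed[OF that]]] l[rule_format, OF that(2,1)]])
        also have "\<dots> = l x * l y * h \<one>"
          using h[OF that(1)] by simp
        finally show ?thesis
          using False by simp
      qed
      have "l \<one> = 1"
        using h[of \<one>] False by simp
      then have "l x \<noteq> 0" if "x \<in> carrier G" for x
        using l_mult[of x "inv x"] that by auto
      then have "\<chi> \<in> Ghat"
        using l_mult by (auto simp: \<chi>_def mem_dual_group_iff)
      then have delta: "(\<Sum>\<psi>\<in>Ghat. (if \<psi> = \<chi> then h \<one> else 0) * \<psi> x) = h \<one> * \<chi> x" for x
        by (simp add: if_distrib[of "\<lambda>c. c * _"] cong: if_cong)
      have "h x = h \<one> * \<chi> x" if "x \<in> carrier G" for x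
        using h[OF that] that by (simp add: \<chi>_def)
      then show ?thesis
        unfolding spanned_def
        by (intro exI[of _ "\<lambda>\<psi>. if \<psi> = \<chi> then h \<one> else 0"] ballI) (simp only: delta)
    qed
  qed
  \<comment> \<open>A collects translations of which h already is an eigenvector, B those still to
    be treated. Empty B is \<open>joint\<close>; empty A allows an arbitrary function.\<close>
  have "\<forall>A\<subseteq>carrier G. A \<union> B = carrier G \<longrightarrow> E A \<subseteq> Collect spanned" if "finite B" "B \<subseteq> carrier G" for B
    using that
  proof (induction B)
    case empty
    then show ?case
      using joint by auto
  next
    case (insert g B)
    show ?case
    proof (intro allI impI subsetI)
      fix A h assume A: "A \<subseteq> carrier G" "A \<union> insert g B = carrier G" and h: "h \<in> E A"
      have g: "g \<in> carrier G"
        using insert by auto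
      define n where "n = order G"
      define w where "w = cis (2 * pi / n)"
      define P where "P k x = (\<Sum>j<n. inverse w ^ (j * k) * h (x \<otimes> g [^] j)) / n" for k x
      have sum_P: "h x = (\<Sum>k<n. P k x)" and P_g: "P k (x \<otimes> g) = w ^ k * P k x"
        if "x \<in> carrier G" for k x
        using translation_eigen_decomposition[OF g that, where f = h] by (simp_all add: P_def w_def n_def)
      \<comment> \<open>Averaging along powers of g commutes with translation by a, so the
        eigenvalues for A survive and g is gained.\<close>
      have "P k \<in> E (insert g A)" for k
      proof -
        have "\<exists>l. \<forall>x\<in>carrier G. P k (x \<otimes> a) = l * P k x" if "a \<in> A" for a
        proof -
          have a: "a \<in> carrier G"
            using that A by auto
          obtain l where l: "\<forall>x\<in>carrier G. h (x \<otimes> a) = l * h x"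
            using h \<open>a \<in> A\<close> by (auto simp: E_def)
          have "h (x \<otimes> a \<otimes> g [^] j) = l * h (x \<otimes> g [^] j)" if "x \<in> carrier G" for x and j :: nat
            using l[rule_format, of "x \<otimes> g [^] j"] a g that by (simp add: m_ac)
          then have "\<forall>x\<in>carrier G. P k (x \<otimes> a) = l * P k x"
            by (simp add: P_def sum_distrib_left mult_ac)
          then show ?thesis ..
        qed
        then show ?thesis
          using P_g by (auto simp: E_def)
      qed
      moreover have "insert g A \<subseteq> carrier G" "insert g A \<union> B = carrier G"
        using A g by auto
      ultimately have "spanned (P k)" for k
        using insert by blast
      then obtain c where c: "\<And>k x. x \<in> carrier G \<Longrightarrow> P k x = (\<Sum>\<chi>\<in>Ghat. c k \<chi> * \<chi> x)"
        unfolding spanned_def by metis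
      have "h x = (\<Sum>\<chi>\<in>Ghat. (\<Sum>k<n. c k \<chi>) * \<chi> x)" if "x \<in> carrier G" for x
        unfolding sum_P[OF that] sum_distrib_right by (subst sum.swap) (simp add: c that)
      then have "spanned h"
        unfolding spanned_def by (intro exI) auto
      then show "h \<in> Collect spanned"
        by simp
    qed
  qed
  from this[of "carrier G"] have "E {} \<subseteq> Collect spanned"
    by auto
  then show ?thesis
    by (auto simp: E_def spanned_def)
qed

lemma coefficient_of_expansion:
  assumes "\<forall>x\<in>carrier G. f x = (\<Sum>\<chi>\<in>Ghat. c \<chi> * \<chi> x)" and "\<psi> \<in> Ghat"
  shows "c \<psi> = (\<Sum>x\<in>carrier G. f x * cnj (\<psi> x)) / order G"
proof -
  have "(\<Sum>x\<in>carrier G. f x * cnj (\<psi> x)) = (\<Sum>\<chi>\<in>Ghat. c \<chi> * (\<Sum>x\<in>carrier G. \<chi> x * cnj (\<psi> x)))"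
    using assms(1) by (simp add: sum_distrib_right sum_distrib_left mult.assoc) (rule sum.swap)
  also have "\<dots> = (\<Sum>\<chi>\<in>Ghat. if \<chi> = \<psi> then c \<chi> * order G else 0)"
    using assms(2) by (intro sum.cong) (auto simp: character_orthogonality)
  also have "\<dots> = c \<psi> * order G"
    using assms(2) by simp
  finally show ?thesis
    using order_pos by simp
qed

text \<open>Existence by \<open>characters_span\<close> and uniqueness by
  \<open>coefficient_of_expansion\<close> resolve the definite description in
  \<open>fourier_coeff\<close>.\<close>

lemma fourier_coeff_eq:
  assumes "\<psi> \<in> Ghat"
  shows "fourier_coeff G f \<psi> = (\<Sum>x\<in>carrier G. f x * cnj (\<psi> x)) / order G"
proof -
  let ?P = "\<lambda>c. c \<in> extensional Ghat \<and> (\<forall>x\<in>carrier G. f x = (\<Sum>\<chi>\<in>Ghat. c \<chi> * \<chi> x))"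
  obtain c where "\<forall>x\<in>carrier G. f x = (\<Sum>\<chi>\<in>Ghat. c \<chi> * \<chi> x)"
    using characters_span by blast
  then have ex: "?P (restrict c Ghat)"
    by auto
  have unique: "c = c'" if "?P c" "?P c'" for c c'
  proof (rule extensionalityI)
    fix \<chi> assume "\<chi> \<in> Ghat"
    then show "c \<chi> = c' \<chi>"
      using coefficient_of_expansion[OF conjunct2[OF \<open>?P c\<close>]]
        coefficient_of_expansion[OF conjunct2[OF \<open>?P c'\<close>]] by simp
  qed (use that in auto)
  have "?P (fourier_coeff G f)"
    unfolding fourier_coeff_def by (rule theI[of ?P, OF ex unique[OF _ ex]])
  then show ?thesis
    using assms by (intro coefficient_of_expansion) auto
qed

text \<open>Expand the point mass at x in characters: its coefficients are
  \<open>cnj (\<chi> x) / order G\<close>, and evaluation at y gives the claim without counting the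
  characters.\<close>

lemma dual_orthogonality:
  assumes "x \<in> carrier G" "y \<in> carrier G"
  shows "(\<Sum>\<chi>\<in>Ghat. cnj (\<chi> x) * \<chi> y) = (if x = y then of_nat (order G) else 0)"
proof -
  let ?d = "\<lambda>y. if x = y then 1 else 0 :: complex"
  obtain c where c: "\<forall>y\<in>carrier G. ?d y = (\<Sum>\<chi>\<in>Ghat. c \<chi> * \<chi> y)"
    using characters_span[of ?d] by blast
  have "c \<chi> = cnj (\<chi> x) / order G" if "\<chi> \<in> Ghat" for \<chi>
    using coefficient_of_expansion[OF c that] assms
    by (simp add: if_distrib[of "\<lambda>z. z * _"] cong: if_cong)
  then have "?d y = (\<Sum>\<chi>\<in>Ghat. cnj (\<chi> x) * \<chi> y) / order G"
    using c assms by (simp add: sum_divide_distrib)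
  then show ?thesis
    using order_pos by (simp add: field_simps split: if_splits)
qed

end

section \<open>Sparse Gram matrices and sums of squares\<close>

text \<open>Each square is the product of a sum with its conjugate. The final calculation uses this
  twice: for the clique-supported vectors and for the Gram vectors, read as families indexed by
  group elements.\<close>

lemma sum_hermitian_squares:
  fixes z :: "'v \<Rightarrow> complex" and b :: "'k \<Rightarrow> 'v \<Rightarrow> complex"
  shows "(\<Sum>u\<in>V. \<Sum>v\<in>V. z u * cnj (z v) * (\<Sum>k\<in>K. b k v * cnj (b k u))) =
    (\<Sum>k\<in>K. of_real ((cmod (\<Sum>u\<in>V. cnj (b k u) * z u))\<^sup>2))"
proof -
  have "(\<Sum>u\<in>V. \<Sum>v\<in>V. z u * cnj (z v) * (\<Sum>k\<in>K. b k v * cnj (b k u))) =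
      (\<Sum>u\<in>V. \<Sum>k\<in>K. \<Sum>v\<in>V. (cnj (b k u) * z u) * cnj (cnj (b k v) * z v))"
    unfolding sum_distrib_left by (intro sum.cong refl, subst sum.swap) (simp add: mult_ac)
  also have "\<dots> = (\<Sum>k\<in>K. \<Sum>u\<in>V. \<Sum>v\<in>V. (cnj (b k u) * z u) * cnj (cnj (b k v) * z v))"
    by (rule sum.swap)
  also have "\<dots> = (\<Sum>k\<in>K. of_real ((cmod (\<Sum>u\<in>V. cnj (b k u) * z u))\<^sup>2))"
    by (simp only: complex_norm_square sum_product cnj_sum)
  finally show ?thesis .
qed

text \<open>Cholesky factorisation along a perfect elimination ordering: for a simplicial vertex \<open>v\<close>,
  projecting all vectors onto the orthogonal complement of \<open>a v\<close> subtracts from the Gram matrix a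
  rank-one matrix supported on the clique of \<open>v\<close> and its neighbours.\<close>

lemma (in pair_graph) gram_matrix_clique_decomposition:
  fixes a :: "'a \<Rightarrow> 'x \<Rightarrow> complex"
  assumes "chordal G" and "finite X" and "W \<subseteq> pverts G"
    and "\<And>u v. u \<in> W \<Longrightarrow> v \<in> W \<Longrightarrow> u \<noteq> v \<Longrightarrow> (u, v) \<notin> parcs G \<Longrightarrow>
           (\<Sum>x\<in>X. a u x * cnj (a v x)) = 0"
  shows "\<exists>(J::nat) w. (\<forall>j<J. clique G {u\<in>W. w j u \<noteq> 0}) \<and>
    (\<forall>u\<in>W. \<forall>v\<in>W. (\<Sum>x\<in>X. a u x * cnj (a v x)) = (\<Sum>j<J. w j u * cnj (w j v)))"
  using assms(3,4)
proof (induction "card W" arbitrary: W a rule: less_induct)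
  case less
  show ?case
  proof (cases "W = {}")
    case False
    have fin: "finite W"
      using less.prems(1) pair_finite_verts finite_subset by blast
    obtain v where v: "v \<in> W" and nbhd: "clique G (insert v {u\<in>W. (v, u) \<in> parcs G})"
      using chordal_simplicial_vertex[OF \<open>chordal G\<close> less.prems(1) False] by blast
    have sym: "(u', u) \<in> parcs G" if "(u, u') \<in> parcs G" for u u'
      using that pair_sym_arcs by (auto simp: symmetric_def dest: symD)
    define M where "M u u' = (\<Sum>x\<in>X. a u x * cnj (a u' x))" for u u'
    define r where "r = (\<Sum>x\<in>X. (cmod (a v x))\<^sup>2)"
    have Mvv: "M v v = of_real r"
      unfolding M_def r_def of_real_sum complex_norm_square ..
    have r: "r \<ge> 0"
      unfolding r_def by (intro sum_nonneg) simp
    have cnj_M: "cnj (M u u') = M u' u" for u u'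
      by (simp add: M_def mult.commute)
    have M_zero: "M u u' = 0" if "u \<in> W" "u' \<in> W" "u \<noteq> u'" "(u, u') \<notin> parcs G" for u u'
      using less.prems(2)[OF that] by (simp add: M_def)
    \<comment> \<open>If r = 0, then \<open>a v\<close> vanishes on X, and with it row and column v
      of M. As division by 0 yields 0, the formulas below then cover this case too.\<close>
    have r0: "M v u = 0" "M u v = 0" if "r = 0" for u
    proof -
      have "\<forall>x\<in>X. a v x = 0"
        using \<open>finite X\<close> that by (simp add: r_def sum_nonneg_eq_0_iff)
      then show "M v u = 0" "M u v = 0"
        by (simp_all add: M_def)
    qed
    have Mv: "M v u = of_real r * M v u / of_real r" "M u v = M u v * of_real r / of_real r" for u
      by (cases "r = 0"; simp add: r0)+
    define a' where "a' u x = a u x - M u v / of_real r * a v x" for u x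
    \<comment> \<open>The new Gram matrix is the Schur complement of the entry
      \<open>M v v\<close>.\<close>
    have gram': "(\<Sum>x\<in>X. a' u x * cnj (a' u' x)) = M u u' - M u v * M v u' / of_real r" for u u'
    proof -
      define p q where "p = M u v / of_real r" and "q = M u' v / of_real r"
      have "(\<Sum>x\<in>X. a' u x * cnj (a' u' x)) = (\<Sum>x\<in>X. a u x * cnj (a u' x) - p * (a v x * cnj (a u' x))
          - cnj q * (a u x * cnj (a v x)) + p * cnj q * (a v x * cnj (a v x)))"
        by (simp add: a'_def algebra_simps flip: p_def q_def)
      also have "\<dots> = M u u' - p * M v u' - cnj q * M u v + p * cnj q * M v v"
        by (simp add: M_def sum.distrib sum_subtractf sum_distrib_left)
      also have "cnj q = M v u' / of_real r"
        by (simp add: q_def cnj_M)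
      finally have "(\<Sum>x\<in>X. a' u x * cnj (a' u' x)) =
          M u u' - p * M v u' - M v u' / of_real r * M u v + p * (M v u' / of_real r) * M v v" .
      then show ?thesis
        unfolding Mvv p_def by (cases "r = 0") (simp_all add: mult.commute)
    qed
    \<comment> \<open>No fill-in: the correction term is nonzero only if u and u' are both
      neighbours of v, and then they are adjacent because v is simplicial.\<close>
    have zero': "(\<Sum>x\<in>X. a' u x * cnj (a' u' x)) = 0"
      if u: "u \<in> W - {v}" "u' \<in> W - {v}" "u \<noteq> u'" "(u, u') \<notin> parcs G" for u u'
    proof -
      have "(v, u) \<notin> parcs G \<or> (v, u') \<notin> parcs G"
        using nbhd u unfolding clique_def by blast
      then have "M u v = 0 \<or> M v u' = 0"
        using M_zero[of v u'] M_zero[of u v] sym u v by blast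
      then show ?thesis
        unfolding gram' using M_zero[of u u'] u by auto
    qed
    have "card (W - {v}) < card W"
      using fin v by (intro psubset_card_mono) auto
    then have "\<exists>(J::nat) w. (\<forall>j<J. clique G {u\<in>W - {v}. w j u \<noteq> 0}) \<and>
      (\<forall>u\<in>W - {v}. \<forall>u'\<in>W - {v}.
        (\<Sum>x\<in>X. a' u x * cnj (a' u' x)) = (\<Sum>j<J. w j u * cnj (w j u')))"
      by (rule less.hyps) (use zero' less.prems(1) in auto)
    then obtain J :: nat and w where cl: "\<forall>j<J. clique G {u\<in>W - {v}. w j u \<noteq> 0}"
      and w: "\<forall>u\<in>W - {v}. \<forall>u'\<in>W - {v}.
        (\<Sum>x\<in>X. a' u x * cnj (a' u' x)) = (\<Sum>j<J. w j u * cnj (w j u'))"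
      by (elim exE conjE)
    \<comment> \<open>Index J carries the rank-one matrix of v, with \<open>sqrt r\<close> because
      two factors must produce 1/r. The older vectors, controlled only on W without v, are set to 0
      at v.\<close>
    define w' where
      "w' j u = (if j = J then M u v / of_real (sqrt r) else if u = v then 0 else w j u)" for j :: nat and u
    have "clique G {u\<in>W. w' j u \<noteq> 0}" if "j < Suc J" for j
    proof (cases "j = J")
      case True
      have "{u\<in>W. w' j u \<noteq> 0} \<subseteq> insert v {u\<in>W. (v, u) \<in> parcs G}"
        using M_zero[OF _ v] sym by (auto simp: w'_def True)
      then show ?thesis
        by (rule clique_subset[OF nbhd])
    next
      case False
      then have "{u\<in>W. w' j u \<noteq> 0} = {u\<in>W - {v}. w j u \<noteq> 0}"
        by (auto simp: w'_def)
      then show ?thesis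
        using cl that False by simp
    qed
    moreover have "(\<Sum>x\<in>X. a u x * cnj (a u' x)) = (\<Sum>j<Suc J. w' j u * cnj (w' j u'))"
      if u: "u \<in> W" "u' \<in> W" for u u'
    proof -
      have "w' J u * cnj (w' J u') = M u v * M v u' / (of_real (sqrt r) * of_real (sqrt r))"
        by (simp add: w'_def cnj_M)
      also have "\<dots> = M u v * M v u' / of_real r"
        using r by (simp flip: of_real_mult)
      finally have wJ: "w' J u * cnj (w' J u') = M u v * M v u' / of_real r" .
      show ?thesis
      proof (cases "u = v \<or> u' = v")
        case True
        then have "(\<Sum>j<J. w' j u * cnj (w' j u')) = 0"
          by (auto simp: w'_def intro: sum.neutral)
        moreover have "M u u' = M u v * M v u' / of_real r"
          using True Mv(1)[of u'] Mv(2)[of u] by (elim disjE) (simp_all only: Mvv)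
        ultimately show ?thesis
          by (simp add: wJ flip: M_def)
      next
        case False
        then have "(\<Sum>j<J. w' j u * cnj (w' j u')) = M u u' - M u v * M v u' / of_real r"
          using w u gram'[of u u'] by (simp add: w'_def)
        then show ?thesis
          by (simp add: wJ flip: M_def)
      qed
    qed
    ultimately show ?thesis
      by (intro exI[of _ "Suc J"] exI[of _ w']) blast
  qed (auto intro: exI[of _ 0])
qed

section \<open>From the clique decomposition to sums of squares on the group\<close>

theorem theorem1:
  fixes G :: "('a, 'b) monoid_scheme"
    and S :: "('a \<Rightarrow> complex) set"
    and \<Gamma> :: "('a \<Rightarrow> complex) pair_pre_digraph"
    and t :: "('a \<Rightarrow> complex) set \<Rightarrow> ('a \<Rightarrow> complex)"
    and f :: "'a \<Rightarrow> real"
  assumes "comm_group G" and "finite (carrier G)"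
    and "S \<subseteq> carrier (dual_group G)"
    and "\<And>\<chi>. \<chi> \<in> S \<Longrightarrow> inv\<^bsub>dual_group G\<^esub> \<chi> \<in> S"
    and "chordal_cover \<Gamma> (cayley_graph (dual_group G) S)"
    and "\<And>C. maximal_clique \<Gamma> C \<Longrightarrow> t C \<in> carrier (dual_group G)"
    and "\<And>x. x \<in> carrier G \<Longrightarrow> f x \<ge> 0"
    and "supported_on G (\<lambda>x. complex_of_real (f x)) S"
  shows "\<exists>(J::nat) (F :: nat \<Rightarrow> 'a \<Rightarrow> complex).
           (\<forall>j\<in>{1..J}. supported_on G (F j) (clique_translates (dual_group G) \<Gamma> t)) \<and>
           (\<forall>x\<in>carrier G. f x = (\<Sum>j=1..J. (cmod (F j x))\<^sup>2))"
proof -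
  interpret finite_comm_group G
    using assms(1,2) by (simp add: finite_comm_group_def finite_comm_group_axioms_def)
  interpret D: comm_group "dual_group G"
    by (rule comm_group_dual_group)
  interpret \<Gamma>: pair_graph \<Gamma>
    using assms(5) by (simp add: chordal_cover_def)
  have verts: "pverts \<Gamma> = Ghat" and arcs: "parcs (cayley_graph (dual_group G) S) \<subseteq> parcs \<Gamma>"
    and chordal: "chordal \<Gamma>"
    using assms(5) by (auto simp: chordal_cover_def spanning_def subgraph_def cayley_graph_def)
  define n where "n = order G"
  have n: "n > 0"
    using order_pos by (simp add: n_def)
  \<comment> \<open>The weight \<open>sqrt (f x)\<close> presents the matrix of f as a Gram matrix;
    \<open>aa\<close> is where f must be nonnegative.\<close>
  define a where "a \<chi> x = of_real (sqrt (f x)) * \<chi> x" for \<chi> :: "'a \<Rightarrow> complex" and x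
  have aa: "a \<chi> x * cnj (a \<psi> x) = of_real (f x) * (\<chi> x * cnj (\<psi> x))" if "x \<in> carrier G" for \<chi> \<psi> x
  proof -
    have "a \<chi> x * cnj (a \<psi> x) = of_real (sqrt (f x) * sqrt (f x)) * (\<chi> x * cnj (\<psi> x))"
      by (simp add: a_def del: real_sqrt_mult_self)
    then show ?thesis
      using assms(7)[OF that] by (simp del: of_real_mult)
  qed
  have sparse: "(\<Sum>x\<in>carrier G. a \<chi> x * cnj (a \<psi> x)) = 0"
    if \<chi>\<psi>: "\<chi> \<in> pverts \<Gamma>" "\<psi> \<in> pverts \<Gamma>" "\<chi> \<noteq> \<psi>" "(\<chi>, \<psi>) \<notin> parcs \<Gamma>" for \<chi> \<psi>
  proof -
    \<comment> \<open>Nonadjacency puts this quotient outside S, and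
      \<open>cnj (\<xi> x) = \<chi> x * cnj (\<psi> x)\<close> turns the matrix entry into
      \<open>order G\<close> times the Fourier coefficient at it.\<close>
    define \<xi> where "\<xi> = inv\<^bsub>dual_group G\<^esub> \<chi> \<otimes>\<^bsub>dual_group G\<^esub> \<psi>"
    have mem: "\<chi> \<in> Ghat" "\<psi> \<in> Ghat"
      using \<chi>\<psi> verts by auto
    then have \<xi>: "\<xi> \<in> Ghat"
      unfolding \<xi>_def by (intro D.m_closed D.inv_closed)
    have "\<xi> \<notin> S"
      using \<chi>\<psi> mem arcs by (auto simp: cayley_graph_def \<xi>_def)
    with assms(8) \<xi> have "fourier_coeff G (\<lambda>x. complex_of_real (f x)) \<xi> = 0"
      by (auto simp: supported_on_def)
    then have "(\<Sum>x\<in>carrier G. of_real (f x) * cnj (\<xi> x)) = 0"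
      using \<xi> order_pos by (simp add: fourier_coeff_eq)
    moreover have "cnj (\<xi> x) = \<chi> x * cnj (\<psi> x)" if "x \<in> carrier G" for x
      using mem that by (simp add: \<xi>_def inv_dual_group flip: cnj_character)
    ultimately show ?thesis
      by (simp add: aa)
  qed
  have "\<exists>(J::nat) w. (\<forall>j<J. clique \<Gamma> {\<chi>\<in>pverts \<Gamma>. w j \<chi> \<noteq> 0}) \<and>
    (\<forall>\<chi>\<in>pverts \<Gamma>. \<forall>\<psi>\<in>pverts \<Gamma>.
      (\<Sum>x\<in>carrier G. a \<chi> x * cnj (a \<psi> x)) = (\<Sum>j<J. w j \<chi> * cnj (w j \<psi>)))"
    by (rule \<Gamma>.gram_matrix_clique_decomposition[OF chordal finite_carrier subset_refl]) (rule sparse)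
  then obtain J :: nat and w where cl: "\<forall>j<J. clique \<Gamma> {\<chi>\<in>Ghat. w j \<chi> \<noteq> 0}"
    and w: "\<forall>\<chi>\<in>Ghat. \<forall>\<psi>\<in>Ghat.
      (\<Sum>x\<in>carrier G. a \<chi> x * cnj (a \<psi> x)) = (\<Sum>j<J. w j \<chi> * cnj (w j \<psi>))"
    unfolding verts by (elim exE conjE)
  have "\<forall>j\<in>{..<J}. \<exists>C. maximal_clique \<Gamma> C \<and> {\<chi>\<in>Ghat. w j \<chi> \<noteq> 0} \<subseteq> C"
    using cl \<Gamma>.clique_maximal_extension by simp
  from bchoice[OF this] obtain C where C: "\<And>j. j < J \<Longrightarrow> maximal_clique \<Gamma> (C j)"
    "\<And>j \<chi>. j < J \<Longrightarrow> \<chi> \<in> Ghat \<Longrightarrow> w j \<chi> \<noteq> 0 \<Longrightarrow> \<chi> \<in> C j"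
    by blast
  \<comment> \<open>The conjugated weights are those produced by
    \<open>sum_hermitian_squares\<close>, and 1/n cancels the factor n from dual orthogonality.
    Multiplying by \<open>t (C j)\<close> moves the support of \<open>w j\<close> into the
    translated clique.\<close>
  define F where "F j x = (\<Sum>\<chi>\<in>Ghat. cnj (w j \<chi>) * (t (C j) \<otimes>\<^bsub>dual_group G\<^esub> \<chi>) x) / n" for j x
  have supp: "supported_on G (F j) (clique_translates (dual_group G) \<Gamma> t)" if j: "j < J" for j
    unfolding supported_on_def
  proof
    fix \<xi> assume \<xi>: "\<xi> \<in> Ghat - clique_translates (dual_group G) \<Gamma> t"
    have t: "t (C j) \<in> Ghat"
      using assms(6) C j by blast
    \<comment> \<open>In each term either the weight is 0 or the translated character lies in the
      union of the translates, hence differs from \<xi> and is orthogonal to it.\<close>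
    have "(\<Sum>x\<in>carrier G. F j x * cnj (\<xi> x)) =
        (\<Sum>\<chi>\<in>Ghat. cnj (w j \<chi>) * (\<Sum>x\<in>carrier G. (t (C j) \<otimes>\<^bsub>dual_group G\<^esub> \<chi>) x * cnj (\<xi> x))) / n"
      unfolding F_def sum_distrib_right sum_distrib_left sum_divide_distrib times_divide_eq_left
      by (subst sum.swap) (simp only: mult.assoc)
    also have "(\<Sum>\<chi>\<in>Ghat. cnj (w j \<chi>) *
        (\<Sum>x\<in>carrier G. (t (C j) \<otimes>\<^bsub>dual_group G\<^esub> \<chi>) x * cnj (\<xi> x))) = 0"
    proof (rule sum.neutral, rule ballI)
      fix \<chi> assume \<chi>: "\<chi> \<in> Ghat"
      show "cnj (w j \<chi>) * (\<Sum>x\<in>carrier G. (t (C j) \<otimes>\<^bsub>dual_group G\<^esub> \<chi>) x * cnj (\<xi> x)) = 0"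
      proof (cases "w j \<chi> = 0")
        case False
        then have "t (C j) \<otimes>\<^bsub>dual_group G\<^esub> \<chi> \<in> clique_translates (dual_group G) \<Gamma> t"
          using C[OF j] \<chi> unfolding clique_translates_def l_coset_def by blast
        then have "t (C j) \<otimes>\<^bsub>dual_group G\<^esub> \<chi> \<noteq> \<xi>"
          using \<xi> by blast
        then show ?thesis
          using character_orthogonality[OF D.m_closed[OF t \<chi>], of \<xi>] \<xi>
          by (simp del: dual_group_simps)
      qed simp
    qed
    finally show "fourier_coeff G (F j) \<xi> = 0"
      using \<xi> by (simp add: fourier_coeff_eq)
  qed
  have "f x = (\<Sum>j<J. (cmod (F j x))\<^sup>2)" if x: "x \<in> carrier G" for x
  proof -
    have "cmod (F j x) = cmod (\<Sum>\<chi>\<in>Ghat. cnj (w j \<chi>) * \<chi> x) / n" if "j < J" for j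
    proof -
      have "F j x = t (C j) x * (\<Sum>\<chi>\<in>Ghat. cnj (w j \<chi>) * \<chi> x) / n"
        using x by (simp add: F_def sum_distrib_left mult_ac)
      moreover have "cmod (t (C j) x) = 1"
        using assms(6) C that x by (intro norm_character) auto
      ultimately show ?thesis
        by (simp add: norm_mult norm_divide)
    qed
    \<comment> \<open>The squares become a double sum over characters, the Gram identity replaces
      \<open>w\<close> by \<open>a\<close>, and the result splits again into squares, now indexed by
      the points y.\<close>
    then have "of_real (\<Sum>j<J. (cmod (F j x))\<^sup>2) * (of_nat n)\<^sup>2 =
        (\<Sum>j<J. complex_of_real ((cmod (\<Sum>\<chi>\<in>Ghat. cnj (w j \<chi>) * \<chi> x))\<^sup>2))"
      using n by (simp add: power_divide flip: sum_divide_distrib)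
    also have "\<dots> = (\<Sum>\<chi>\<in>Ghat. \<Sum>\<psi>\<in>Ghat. \<chi> x * cnj (\<psi> x) * (\<Sum>j<J. w j \<psi> * cnj (w j \<chi>)))"
      by (rule sum_hermitian_squares[symmetric])
    also have "\<dots> = (\<Sum>\<chi>\<in>Ghat. \<Sum>\<psi>\<in>Ghat. \<chi> x * cnj (\<psi> x) * (\<Sum>y\<in>carrier G. a \<psi> y * cnj (a \<chi> y)))"
      by (simp add: w)
    also have "\<dots> = (\<Sum>y\<in>carrier G. complex_of_real ((cmod (\<Sum>\<chi>\<in>Ghat. cnj (a \<chi> y) * \<chi> x))\<^sup>2))"
      by (rule sum_hermitian_squares)
    \<comment> \<open>Dual orthogonality leaves only y = x.\<close>
    also have "\<dots> = (\<Sum>y\<in>carrier G. if y = x then of_real (f x) * (of_nat n)\<^sup>2 else 0)"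
    proof (rule sum.cong)
      fix y assume y: "y \<in> carrier G"
      have "(\<Sum>\<chi>\<in>Ghat. cnj (a \<chi> y) * \<chi> x) = of_real (sqrt (f y)) * (\<Sum>\<chi>\<in>Ghat. cnj (\<chi> y) * \<chi> x)"
        by (simp add: a_def sum_distrib_left mult.assoc)
      then show "complex_of_real ((cmod (\<Sum>\<chi>\<in>Ghat. cnj (a \<chi> y) * \<chi> x))\<^sup>2) =
          (if y = x then of_real (f x) * (of_nat n)\<^sup>2 else 0)"
        using assms(7)[OF y] by (simp add: dual_orthogonality x y n_def norm_mult power_mult_distrib)
    qed simp
    also have "\<dots> = of_real (f x) * (of_nat n)\<^sup>2"
      using x by simp
    finally have "complex_of_real (f x) = of_real (\<Sum>j<J. (cmod (F j x))\<^sup>2)"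
      using n by simp
    then show ?thesis
      by (simp only: of_real_eq_iff)
  qed
  \<comment> \<open>The theorem numbers the functions from 1 to J, the proof from 0 to J -
    1.\<close>
  then show ?thesis
    using supp
    by (intro exI[of _ J] exI[of _ "\<lambda>j. F (j - 1)"]) (auto simp: sum.atLeast1_atMost_eq)
qed

end
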